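(* The ordinary generating function of the sequence $\delta_P(n)$, $n\ge 1$, is $$\sum_{n\ge 1}\delta_P(n)z^n=\frac{z}{1-z}\left(2\prod_{k\ge 1}\left(1+z^{2^k-1}\right)-\frac{1}{1-z}\right)$$ (as an identity of formal power series).
   Context: $\mathcal{T}_\infty$ is the infinite binary tree with all leaves at the same level: its vertices are the pairs $(i,j)$ of integers with $i\ge 1$, $j\ge 0$; the vertex $(i,j)$ has parent $(i+1,\lfloor j/2\rfloor)$, and the edges join each vertex to its parent. For a finite vertex set $S$, $\overline S$ is its complement and $(S,\overline S)$ is the set of edges with one end in $S$ and the other in $\overline S$. $\delta_P(n)$ is the minimum of $|(S,\overline S)|$ over all $S\subset V(\mathcal{T}_\infty)$ with $|S|=n$ such that $\overline S$ induces a connected subgraph. *)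

theory Defs
  imports
    "HOL-Analysis.Infinite_Products"
    "HOL-Computational_Algebra.Formal_Power_Series"
    "Graph_Theory.Digraph_Component"
begin

fun tree_parent :: "nat \<times> nat \<Rightarrow> nat \<times> nat" where
  "tree_parent (i, j) = (i + 1, j div 2)"

definition tree_verts :: "(nat \<times> nat) set" where
  "tree_verts = {(i, j). 1 \<le> i}"

text \<open>The undirected edge joining a vertex to its parent is stored once, as the arc from child
  to parent; \<open>Digraph_Component.connected\<close> ignores orientation.\<close>

definition binary_tree :: "(nat \<times> nat, (nat \<times> nat) \<times> (nat \<times> nat)) pre_digraph" where
  "binary_tree = with_proj \<lparr> pverts = tree_verts, parcs = {(v, tree_parent v) | v. v \<in> tree_verts} \<rparr>"

definition edge_cut :: "('a, 'b) pre_digraph \<Rightarrow> 'a set \<Rightarrow> 'b set" where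
  "edge_cut G S = {e \<in> arcs G. (tail G e \<in> S \<and> head G e \<in> verts G - S)
                              \<or> (tail G e \<in> verts G - S \<and> head G e \<in> S)}"

definition delta_P :: "nat \<Rightarrow> nat" where
  "delta_P n = (LEAST d. \<exists>S. S \<subseteq> verts binary_tree \<and> finite S \<and> card S = n
      \<and> Digraph_Component.connected (binary_tree \<restriction> (verts binary_tree - S))
      \<and> d = card (edge_cut binary_tree S))"

text \<open>The infinite product converges in the library's metric topology on formal power series,
  in which the coefficients of the partial products are eventually constant; so \<open>prodinf\<close>
  is its actual value.\<close>

lemma convergent_prod_fps:
  "convergent_prod (\<lambda>k. 1 + fps_X ^ (2 ^ Suc k - 1) :: rat fps)"
proof -
  define f :: "nat \<Rightarrow> rat fps" where "f = (\<lambda>k. 1 + fps_X ^ (2 ^ Suc k - 1))"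
  define P where "P = (\<lambda>n. \<Prod>i\<le>n. f i)"
  have step: "fps_nth (P (Suc m)) n = fps_nth (P m) n" if "n \<le> m" for m n
  proof -
    have "m < 2 ^ m" by (rule less_exp)
    then have "n < 2 ^ Suc (Suc m) - 1" using that unfolding power_Suc by linarith
    moreover have "P (Suc m) = P m + P m * fps_X ^ (2 ^ Suc (Suc m) - 1)"
      by (simp add: P_def f_def distrib_left)
    ultimately show ?thesis by (simp add: fps_X_power_mult_right_nth del: power_Suc)
  qed
  have stable: "fps_nth (P m) n = fps_nth (P n) n" if "n \<le> m" for m n
    using that by (induction m rule: dec_induct) (auto simp: step)
  have "P \<longlonglongrightarrow> Abs_fps (\<lambda>n. fps_nth (P n) n)"
    by (rule tendsto_fpsI) (auto simp: eventually_sequentially intro!: stable)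
  moreover have "Abs_fps (\<lambda>n. fps_nth (P n) n) \<noteq> 0"
    by (auto simp: fps_eq_iff P_def f_def intro!: exI[of _ 0])
  ultimately have "raw_has_prod f 0 (Abs_fps (\<lambda>n. fps_nth (P n) n))"
    by (simp add: raw_has_prod_def P_def)
  then show ?thesis unfolding convergent_prod_def f_def by blast
qed

end

theory Submission
  imports Defs
begin

text \<open>
  If the complement of a finite set \<open>S\<close> is connected, it contains with every vertex the parent of that
  vertex, so \<open>S\<close> is a disjoint union of full subtrees, and its cut consists of one edge per subtree.
  A full subtree rooted at level \<open>k\<close> has \<open>2^k - 1\<close> vertices, so \<open>\<delta>\<^sub>P(n)\<close> is the least number of parts in a
  partition of \<open>n\<close> into numbers \<open>2^k - 1\<close>. Let \<open>a(m)\<close> be the coefficients of the product and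
  \<open>D(n) = (\<Sum>m<n. 2 a(m) - 1)\<close> (called \<open>min_parts\<close>), the coefficients of the right-hand side. The claim \<open>D = \<delta>\<^sub>P\<close> reduces to two
  facts: \<open>D(2^k - 1 + r) = 1 + D(r)\<close> for \<open>k \<ge> 1\<close> and \<open>0 \<le> r \<le> 2^k - 1\<close>, so the greedy partition has \<open>D(n)\<close> parts, and
  \<open>D(n + 2^j - 1) \<le> D(n) + 1\<close> for all \<open>n\<close>, so no partition has fewer.
\<close>

section \<open>Coefficients of the product\<close>

definition mers :: "nat \<Rightarrow> nat" where
  "mers k = 2 ^ k - 1"

lemma mers_0 [simp]: "mers 0 = 0"
  by (simp add: mers_def)

lemma mers_Suc: "mers (Suc k) = 2 * mers k + 1"
proof -
  have "(1::nat) \<le> 2 ^ k" by simp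
  then show ?thesis unfolding mers_def power_Suc by linarith
qed

lemma less_mers_Suc: "k < mers (Suc k)"
  by (induction k) (auto simp: mers_Suc)

lemma mers_mono: "i \<le> k \<Longrightarrow> mers i \<le> mers k"
  by (simp add: mers_def diff_le_mono)

text \<open>Greedy choice: \<open>mers k\<close> is the largest part that fits, and
  \<open>n < mers (Suc k) = 2 * mers k + 1\<close> bounds the rest.\<close>

lemma mers_interval:
  assumes "1 \<le> n"
  obtains k r where "1 \<le> k" "n = mers k + r" "r \<le> mers k"
proof -
  define k where "k = (LEAST k. n < mers (Suc k))"
  have lt: "n < mers (Suc k)"
    unfolding k_def by (rule LeastI) (rule less_mers_Suc)
  then have "1 \<le> k"
    using assms by (cases k) (auto simp: mers_Suc)
  then have "\<not> n < mers k"
    using not_less_Least[of "k - 1" "\<lambda>k. n < mers (Suc k)"] by (auto simp: k_def)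
  with lt \<open>1 \<le> k\<close> show thesis
    by (intro that[of k "n - mers k"]) (auto simp: mers_Suc)
qed

definition mers_prod :: "rat fps" where
  "mers_prod = (\<Prod>k. 1 + fps_X ^ (2 ^ Suc k - 1))"

definition mers_partial :: "nat \<Rightarrow> rat fps" where
  "mers_partial K = (\<Prod>k<K. 1 + fps_X ^ mers (Suc k))"

lemma mers_partial_Suc_nth:
  "fps_nth (mers_partial (Suc K)) n = fps_nth (mers_partial K) n +
     (if n < mers (Suc K) then 0 else fps_nth (mers_partial K) (n - mers (Suc K)))"
  by (simp add: mers_partial_def distrib_left fps_X_power_mult_right_nth)

text \<open>The exponents \<open>mers 1\<close>, ..., \<open>mers K\<close> sum to
  \<open>2 * mers K - K\<close>.\<close>

lemma mers_partial_eq_0: "2 * mers K < n \<Longrightarrow> fps_nth (mers_partial K) n = 0"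
proof (induction K arbitrary: n)
  case 0
  then show ?case by (simp add: mers_partial_def)
next
  case (Suc K)
  then show ?case by (auto simp: mers_partial_Suc_nth mers_Suc)
qed

lemma mers_partial_stable:
  assumes "K \<le> L" "n < mers (Suc K)"
  shows "fps_nth (mers_partial L) n = fps_nth (mers_partial K) n"
  using assms(1)
proof (induction L rule: dec_induct)
  case (step L)
  then have "n < mers (Suc L)"
    using assms(2) mers_mono[of "Suc K" "Suc L"] by simp
  then show ?case using step by (simp add: mers_partial_Suc_nth)
qed auto

lemma mers_prod_nth:
  assumes "n < mers (Suc K)"
  shows "fps_nth mers_prod n = fps_nth (mers_partial K) n"
proof -
  let ?f = "\<lambda>k. 1 + fps_X ^ (2 ^ Suc k - 1) :: rat fps"
  let ?A = "Abs_fps (\<lambda>n. fps_nth (mers_partial n) n)"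
  have diag: "fps_nth (mers_partial L) i = fps_nth ?A i" if "i \<le> L" for L i
    using mers_partial_stable[OF that less_mers_Suc] by simp
  have "prod ?f {..m} = mers_partial (Suc m)" for m
    by (simp add: mers_partial_def mers_def lessThan_Suc_atMost)
  then have "(\<lambda>m. prod ?f {..m}) \<longlonglongrightarrow> ?A"
    by (auto intro!: tendsto_fpsI eventually_sequentiallyI diag le_SucI simp del: fps_nth_Abs_fps)
  moreover have "fps_nth ?A 0 = 1"
    by (simp add: mers_partial_def)
  \<comment> \<open>\<open>raw_has_prod\<close> asks for a nonzero limit.\<close>
  then have "?A \<noteq> 0"
    by (metis fps_zero_nth zero_neq_one)
  ultimately have "?f has_prod ?A"
    by (simp add: has_prod_def raw_has_prod_def)
  then have "mers_prod = ?A"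
    unfolding mers_prod_def by (rule has_prod_unique[symmetric])
  then show ?thesis
    using diag[of n "max n K"] mers_partial_stable[OF _ assms, of "max n K"] by simp
qed

lemma mers_prod_nonneg: "0 \<le> fps_nth mers_prod n"
proof -
  have "0 \<le> fps_nth (mers_partial K) m" for K m
    by (induction K arbitrary: m) (auto simp: mers_partial_Suc_nth, simp add: mers_partial_def)
  then show ?thesis
    using mers_prod_nth[OF less_mers_Suc[of n]] by simp
qed

lemma mers_prod_nth_0: "fps_nth mers_prod 0 = 1"
  using mers_prod_nth[of 0 0] by (simp add: mers_Suc mers_partial_def)

text \<open>Coefficients count representations as sums of distinct parts. The part
  \<open>mers k\<close> is forced: smaller parts reach at most
  \<open>2 * mers (k - 1) < mers k\<close>, larger ones overshoot. By the same bound, smaller parts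
  cannot make up a second \<open>mers k\<close>.\<close>

lemma mers_prod_shift:
  assumes "1 \<le> k" "m \<le> mers k"
  shows "fps_nth mers_prod (mers k + m) = (if m = mers k then 0 else fps_nth mers_prod m)"
proof -
  obtain l where k: "k = Suc l" using assms(1) by (cases k) auto
  have "fps_nth mers_prod (mers k + m) = fps_nth (mers_partial k) (mers k + m)"
    using assms by (intro mers_prod_nth) (simp add: mers_Suc)
  also have "\<dots> = fps_nth (mers_partial l) m"
    by (simp add: k mers_partial_Suc_nth mers_partial_eq_0 mers_Suc)
  also have "\<dots> = (if m = mers k then 0 else fps_nth mers_prod m)"
    using assms by (auto simp: k mers_prod_nth[of m l] mers_partial_eq_0 mers_Suc)
  finally show ?thesis .
qed

section \<open>The least number of parts\<close>

definition min_parts :: "nat \<Rightarrow> rat" where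
  "min_parts n = (\<Sum>m<n. 2 * fps_nth mers_prod m - 1)"

lemma min_parts_0 [simp]: "min_parts 0 = 0"
  by (simp add: min_parts_def)

lemma min_parts_Suc: "min_parts (Suc n) = min_parts n + (2 * fps_nth mers_prod n - 1)"
  by (simp add: min_parts_def)

lemma min_parts_le_Suc: "min_parts n \<le> min_parts (Suc n) + 1"
  using mers_prod_nonneg[of n] by (simp add: min_parts_Suc)

text \<open>The increments from \<open>mers k\<close> on repeat those from 0 on. The exceptional
  one, at \<open>2 * mers k\<close>, is not yet summed even for \<open>r = mers k\<close>.\<close>

lemma min_parts_add_aux:
  assumes "1 \<le> k" "r \<le> mers k"
  shows "min_parts (mers k + r) = min_parts (mers k) + min_parts r"
  using assms(2)
proof (induction r)
  case (Suc r)
  then show ?case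
    using mers_prod_shift[OF assms(1), of r] by (simp add: min_parts_Suc)
qed auto

lemma min_parts_mers: "1 \<le> k \<Longrightarrow> min_parts (mers k) = 1"
proof (induction k rule: dec_induct)
  case base
  then show ?case by (simp add: mers_Suc min_parts_Suc mers_prod_nth_0)
next
  case (step k)
  \<comment> \<open>The increment at \<open>2 * mers k\<close> is -1 and brings the value 1 + 1 back
    to 1.\<close>
  have "min_parts (mers (Suc k)) = min_parts (Suc (mers k + mers k))"
    by (simp add: mers_Suc mult_2)
  then show ?case
    using step min_parts_add_aux[of k "mers k"] mers_prod_shift[of k "mers k"]
    by (simp add: min_parts_Suc)
qed

lemma min_parts_add:
  "\<lbrakk>1 \<le> k; r \<le> mers k\<rbrakk> \<Longrightarrow> min_parts (mers k + r) = 1 + min_parts r"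
  by (simp add: min_parts_add_aux min_parts_mers)

text \<open>For the carry case of \<open>min_parts_add_le\<close>. Raising \<open>d\<close> by one
  turns the argument \<open>t\<close> into \<open>mers k + Suc t\<close>; the extra part makes up
  for a possible drop from \<open>t\<close> to \<open>Suc t\<close>.\<close>

lemma min_parts_le_shift:
  assumes "1 \<le> j" "s < mers j"
  shows "min_parts s \<le> 1 + min_parts (Suc s + (mers (j + d) - mers j))"
  using assms
proof (induction d)
  case 0
  then show ?case using min_parts_le_Suc[of s] by simp
next
  case (Suc d)
  define k where "k = j + d"
  have k: "1 \<le> k" "mers j \<le> mers k" using Suc by (auto simp: k_def intro: mers_mono)
  define t where "t = Suc s + (mers k - mers j)"
  have eq: "Suc s + (mers (j + Suc d) - mers j) = mers k + Suc t"
    using k by (simp add: t_def mers_Suc flip: k_def)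
  show ?case
  proof (cases "Suc t \<le> mers k")
    case True
    have "min_parts s \<le> 1 + min_parts t" using Suc by (simp add: t_def k_def)
    then show ?thesis
      using min_parts_add[OF k(1) True] min_parts_le_Suc[of t] eq by simp
  next
    case False
    \<comment> \<open>Always \<open>t \<le> mers k\<close>, so here \<open>t = mers k\<close>: the
      argument is a single part and \<open>s\<close> is one below a part.\<close>
    then have "Suc s = mers j" "mers k + Suc t = mers (Suc k)"
      using Suc.prems k by (auto simp: t_def mers_Suc)
    then show ?thesis
      using eq min_parts_mers[of "Suc k"] min_parts_mers[of j] min_parts_le_Suc[of s] Suc.prems
      by simp
  qed
qed

text \<open>
  Strong induction on \<open>n\<close>: after splitting off the greedy part \<open>mers k\<close> of \<open>n\<close>, a carry can only come
  from \<open>2 * mers k + 1 = mers (Suc k)\<close>.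
\<close>
lemma min_parts_add_le:
  assumes "1 \<le> j"
  shows "min_parts (n + mers j) \<le> min_parts n + 1"
proof (induction n rule: less_induct)
  case (less n)
  show ?case
  proof (cases "n \<le> mers j")
    case True
    then show ?thesis using min_parts_add[OF assms True] by (simp add: add.commute)
  next
    case False
    then obtain k r where k: "1 \<le> k" "n = mers k + r" "r \<le> mers k"
      using mers_interval[of n] by (metis One_nat_def Suc_leI gr0I zero_le)
    have "j \<le> k"
    proof (rule ccontr)
      assume "\<not> j \<le> k"
      then have "mers (Suc k) \<le> mers j" by (intro mers_mono) simp
      with k False show False by (simp add: mers_Suc)
    qed
    then obtain d where d: "k = j + d" using le_Suc_ex by blast
    have jk: "mers j \<le> mers k" by (rule mers_mono) fact
    have pos: "0 < mers k" using mers_mono[OF k(1)] by (simp add: mers_Suc)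
    have n: "min_parts n = 1 + min_parts r" using min_parts_add k by simp
    show ?thesis
    proof (cases "r + mers j \<le> mers k")
      case True
      then have "min_parts (n + mers j) = 1 + min_parts (r + mers j)"
        using min_parts_add[OF k(1) True] k by (simp add: add.assoc)
      moreover have "min_parts (r + mers j) \<le> min_parts r + 1"
        using less.IH[of r] k pos by simp
      ultimately show ?thesis using n by simp
    next
      case False
      \<comment> \<open>The sum now reaches \<open>mers (Suc k) = 2 * mers k + 1\<close>, and
        \<open>s\<close> is the excess over it.\<close>
      define s where "s = r + mers j - mers k - 1"
      have s: "r = Suc s + (mers k - mers j)" "s < mers j" "n + mers j = mers (Suc k) + s"
        using False jk k by (auto simp: s_def mers_Suc)
      have "s \<le> mers (Suc k)" using s(2) jk by (simp add: mers_Suc)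
      then have "min_parts (n + mers j) = 1 + min_parts s"
        using min_parts_add[of "Suc k" s] s(3) by simp
      then show ?thesis using min_parts_le_shift[OF assms s(2), of d] n s(1) d by simp
    qed
  qed
qed

text \<open>The lower bound for every partition: the parts are added one by one, each raising
  \<open>min_parts\<close> by at most 1.\<close>

lemma min_parts_sum_le:
  assumes "finite R" "\<And>v. v \<in> R \<Longrightarrow> 1 \<le> h v"
  shows "min_parts (\<Sum>v\<in>R. mers (h v)) \<le> of_nat (card R)"
  using assms
proof (induction R rule: finite_induct)
  case (insert v R)
  have "min_parts (mers (h v) + (\<Sum>v\<in>R. mers (h v))) \<le> min_parts (\<Sum>v\<in>R. mers (h v)) + 1"
    using min_parts_add_le[of "h v" "\<Sum>v\<in>R. mers (h v)"] insert by (simp add: add.commute)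
  moreover have "min_parts (\<Sum>v\<in>R. mers (h v)) \<le> of_nat (card R)" using insert by simp
  ultimately show ?case using insert.hyps by simp
qed simp

text \<open>Multiplication by \<open>1 / (1 - fps_X)\<close> forms partial sums; the factor
  \<open>fps_X\<close> makes them stop before \<open>n\<close>.\<close>

lemma min_parts_fps:
  "Abs_fps min_parts = fps_X / (1 - fps_X) * (2 * mers_prod - 1 / (1 - fps_X))"
proof -
  let ?G = "Abs_fps (\<lambda>_. 1 :: rat)"
  have "(1 - fps_X) * ?G = 1"
    by (rule fps_ext) (simp add: left_diff_distrib)
  then have inv: "inverse (1 - fps_X) = ?G" by (rule fps_inverse_unique)
  have "Abs_fps min_parts = fps_X * ((2 * mers_prod - ?G) * ?G)"
  proof (rule fps_ext)
    fix n
    have two: "fps_nth (2 * mers_prod) i = 2 * fps_nth mers_prod i" for i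
      by (simp only: mult_2 fps_add_nth)
    have G: "fps_nth (f * ?G) m = (\<Sum>i<Suc m. fps_nth f i)" for f m
      unfolding fps_mult_nth fps_nth_Abs_fps mult_1_right
      by (rule sum.cong) auto
    show "fps_nth (Abs_fps min_parts) n = fps_nth (fps_X * ((2 * mers_prod - ?G) * ?G)) n"
      unfolding fps_X_mult_nth G
      by (cases n) (simp_all add: min_parts_def two)
  qed
  then show ?thesis by (simp add: fps_divide_unit inv mult_ac)
qed

section \<open>Full subtrees and down-closed sets\<close>

lemma tree_parent_fst [simp]: "fst (tree_parent v) = Suc (fst v)"
  by (cases v) simp

lemma tree_parent_in [simp]: "tree_parent v \<in> tree_verts"
  by (cases v) (simp add: tree_verts_def)

lemma tree_parent_pow: "(tree_parent ^^ m) (i, j) = (i + m, j div 2 ^ m)"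
  by (induction m) (auto simp: div_mult2_eq mult.commute[of 2])

lemma tree_parent_pow_in: "v \<in> tree_verts \<Longrightarrow> (tree_parent ^^ m) v \<in> tree_verts"
  by (induction m) auto

definition subtree :: "nat \<times> nat \<Rightarrow> (nat \<times> nat) set" where
  "subtree v = {w \<in> tree_verts. \<exists>m. (tree_parent ^^ m) w = v}"

lemma subtree_self: "v \<in> tree_verts \<Longrightarrow> v \<in> subtree v"
  by (auto simp: subtree_def intro!: exI[of _ 0])

lemma subtree_subset_verts: "subtree v \<subseteq> tree_verts"
  by (auto simp: subtree_def)

lemma subtree_child: "\<lbrakk>w \<in> tree_verts; tree_parent w \<in> subtree v\<rbrakk> \<Longrightarrow> w \<in> subtree v"
  unfolding subtree_def by clarify (metis comp_apply funpow_Suc_right)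

lemma subtree_parent:
  assumes "w \<in> subtree v" "w \<noteq> v"
  shows "tree_parent w \<in> subtree v"
proof -
  obtain m where m: "(tree_parent ^^ m) w = v" using assms by (auto simp: subtree_def)
  with assms(2) obtain l where "m = Suc l" by (cases m) auto
  with m show ?thesis by (auto simp: subtree_def funpow_swap1)
qed

text \<open>Level 0 lies below the leaves; its empty subtrees let \<open>subtree_Suc\<close> cover
  the leaves too.\<close>

lemma subtree_0: "subtree (0, j) = {}"
  by (auto simp: subtree_def tree_verts_def tree_parent_pow)

lemma subtree_Suc:
  "subtree (Suc i, j) = insert (Suc i, j) (subtree (i, 2 * j) \<union> subtree (i, 2 * j + 1))"
proof (intro equalityI subsetI)
  fix w assume w: "w \<in> subtree (Suc i, j)"
  then obtain m where m: "(tree_parent ^^ m) w = (Suc i, j)" and wv: "w \<in> tree_verts"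
    by (auto simp: subtree_def)
  show "w \<in> insert (Suc i, j) (subtree (i, 2 * j) \<union> subtree (i, 2 * j + 1))"
  proof (cases m)
    case (Suc l)
    obtain a b where ab: "(tree_parent ^^ l) w = (a, b)" by fastforce
    then have "a = i" "b div 2 = j" using m Suc by auto
    then have "(tree_parent ^^ l) w = (i, 2 * j) \<or> (tree_parent ^^ l) w = (i, 2 * j + 1)"
      using ab by auto
    then show ?thesis using wv by (auto simp: subtree_def)
  qed (use m in auto)
next
  fix w assume "w \<in> insert (Suc i, j) (subtree (i, 2 * j) \<union> subtree (i, 2 * j + 1))"
  then consider "w = (Suc i, j)" | m where "w \<in> tree_verts" "(tree_parent ^^ m) w = (i, 2 * j)"
    | m where "w \<in> tree_verts" "(tree_parent ^^ m) w = (i, 2 * j + 1)"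
    by (auto simp: subtree_def)
  then show "w \<in> subtree (Suc i, j)"
  proof cases
    case 1
    then show ?thesis by (simp add: subtree_self tree_verts_def)
  next
    case 2
    then have "(tree_parent ^^ Suc m) w = (Suc i, j)" by simp
    then show ?thesis using 2 unfolding subtree_def by blast
  next
    case 3
    then have "(tree_parent ^^ Suc m) w = (Suc i, j)" by simp
    then show ?thesis using 3 unfolding subtree_def by blast
  qed
qed

lemma subtree_fst_le: "w \<in> subtree v \<Longrightarrow> fst w \<le> fst v"
  by (cases w) (auto simp: subtree_def tree_parent_pow)

lemma subtree_level_disjoint:
  assumes "j \<noteq> j'" shows "subtree (i, j) \<inter> subtree (i, j') = {}"
  using assms by (auto simp: subtree_def tree_parent_pow)

lemma finite_card_subtree: "finite (subtree (i, j)) \<and> card (subtree (i, j)) = mers i"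
proof (induction i arbitrary: j)
  case (Suc i)
  have "(Suc i, j) \<notin> subtree (i, 2 * j) \<union> subtree (i, 2 * j + 1)"
    using subtree_fst_le by fastforce
  moreover have "card (subtree (i, 2 * j) \<union> subtree (i, 2 * j + 1)) = 2 * mers i"
    using Suc by (simp add: card_Un_disjoint subtree_level_disjoint)
  ultimately show ?case using Suc by (simp add: subtree_Suc mers_Suc)
qed (simp add: subtree_0)

section \<open>Decomposition of down-closed sets into full subtrees\<close>

definition down_closed :: "(nat \<times> nat) set \<Rightarrow> bool" where
  "down_closed S \<longleftrightarrow> S \<subseteq> tree_verts \<and> (\<forall>w\<in>tree_verts. tree_parent w \<in> S \<longrightarrow> w \<in> S)"

text \<open>For finite down-closed \<open>S\<close>, these are the roots of the disjoint full
  subtrees that make up \<open>S\<close>.\<close>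

definition tops :: "(nat \<times> nat) set \<Rightarrow> (nat \<times> nat) set" where
  "tops S = {v \<in> S. tree_parent v \<notin> S}"

lemma down_closed_subtree: "down_closed (subtree v)"
  using subtree_subset_verts subtree_child by (auto simp: down_closed_def)

lemma subtree_subset:
  assumes "down_closed S" "v \<in> S"
  shows "subtree v \<subseteq> S"
proof
  fix w assume "w \<in> subtree v"
  then obtain m where "(tree_parent ^^ m) w = v" "w \<in> tree_verts" by (auto simp: subtree_def)
  then show "w \<in> S"
  proof (induction m arbitrary: w)
    case (Suc m)
    then have "tree_parent w \<in> S" by (simp add: funpow_swap1)
    then show ?case using assms Suc by (auto simp: down_closed_def)
  qed (use assms in simp)
qed

lemma tops_subtree:
  assumes "v \<in> tree_verts" shows "tops (subtree v) = {v}"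
proof -
  have "tree_parent v \<notin> subtree v" using subtree_fst_le[of "tree_parent v" v] by auto
  then show ?thesis
    using assms subtree_parent subtree_self unfolding tops_def by blast
qed

text \<open>Each step up raises the level, so the ancestors are pairwise distinct.\<close>

lemma exists_ancestor_notin:
  fixes w :: "nat \<times> nat"
  assumes "finite S"
  obtains m where "(tree_parent ^^ m) w \<notin> S"
proof -
  have "inj (\<lambda>m. (tree_parent ^^ m) w)"
    by (cases w) (auto simp: inj_def tree_parent_pow)
  then have "infinite (range (\<lambda>m. (tree_parent ^^ m) w))"
    by (simp add: finite_image_iff)
  then have "\<not> range (\<lambda>m. (tree_parent ^^ m) w) \<subseteq> S"
    using assms finite_subset by blast
  then show thesis using that by blast
qed

lemma tops_cover:
  assumes "finite S" "down_closed S"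
  shows "(\<Union>v\<in>tops S. subtree v) = S"
proof
  show "(\<Union>v\<in>tops S. subtree v) \<subseteq> S"
    using subtree_subset[OF assms(2)] by (auto simp: tops_def)
  show "S \<subseteq> (\<Union>v\<in>tops S. subtree v)"
  proof
    fix w assume w: "w \<in> S"
    \<comment> \<open>The first ancestor of \<open>w\<close> outside \<open>S\<close>; the vertex
      just before it on the way up is a top.\<close>
    define m where "m = (LEAST m. (tree_parent ^^ m) w \<notin> S)"
    obtain m' where m': "(tree_parent ^^ m') w \<notin> S" using exists_ancestor_notin[OF assms(1)] .
    have m: "(tree_parent ^^ m) w \<notin> S" unfolding m_def by (rule LeastI) (rule m')
    obtain l where l: "m = Suc l" using m w by (cases m) auto
    have "(tree_parent ^^ l) w \<in> S"
      using not_less_Least[of l "\<lambda>m. (tree_parent ^^ m) w \<notin> S"] l by (auto simp: m_def)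
    then have "(tree_parent ^^ l) w \<in> tops S" using m l by (simp add: tops_def)
    moreover have "w \<in> subtree ((tree_parent ^^ l) w)"
      using w assms by (auto simp: subtree_def down_closed_def)
    ultimately show "w \<in> (\<Union>v\<in>tops S. subtree v)" by blast
  qed
qed

text \<open>Two tops above a common vertex lie on one upward path. The parent of the lower one would
  then be in the subtree of the upper one, hence in \<open>S\<close>.\<close>

lemma tops_disjoint:
  assumes "down_closed S" "v \<in> tops S" "v' \<in> tops S" "v \<noteq> v'"
  shows "subtree v \<inter> subtree v' = {}"
proof -
  have wlog: "a = b" if "(tree_parent ^^ m) w = a" "(tree_parent ^^ (m + d)) w = b"
    "a \<in> tops S" "b \<in> tops S" "w \<in> tree_verts" for a b w m d
  proof (cases d)
    case (Suc e)
    have "(tree_parent ^^ e) (tree_parent a) = b"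
      using that Suc by (metis add.commute comp_apply funpow_add funpow_Suc_right)
    then have "tree_parent a \<in> subtree b" by (auto simp: subtree_def)
    then have "tree_parent a \<in> S"
      using subtree_subset[OF assms(1), of b] that(4) unfolding tops_def by blast
    then show ?thesis using that by (simp add: tops_def)
  qed (use that in auto)
  show ?thesis
  proof (rule ccontr)
    assume "subtree v \<inter> subtree v' \<noteq> {}"
    then obtain w m m' where w: "w \<in> tree_verts" "(tree_parent ^^ m) w = v" "(tree_parent ^^ m') w = v'"
      by (auto simp: subtree_def)
    then show False
      using wlog[of m w v "m' - m" v'] wlog[of m' w v' "m - m'" v] assms
      by (cases "m \<le> m'") auto
  qed
qed

lemma card_down_closed:
  assumes "finite S" "down_closed S"
  shows "card S = (\<Sum>v\<in>tops S. mers (fst v))"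
proof -
  have fin: "finite (tops S)" using assms by (simp add: tops_def)
  have "card S = card (\<Union>v\<in>tops S. subtree v)" using tops_cover[OF assms] by simp
  also have "\<dots> = (\<Sum>v\<in>tops S. card (subtree v))"
    using fin finite_card_subtree tops_disjoint[OF assms(2)]
    by (intro card_UN_disjoint) (auto simp: split_paired_all)
  also have "\<dots> = (\<Sum>v\<in>tops S. mers (fst v))"
    using finite_card_subtree by (intro sum.cong) (auto simp: split_paired_all)
  finally show ?thesis .
qed

text \<open>Realizes the greedy partition: a subtree with \<open>mers k\<close> vertices is placed
  apart from a set built for the remainder \<open>r\<close>.\<close>

lemma exists_down_closed:
  "\<exists>S. finite S \<and> down_closed S \<and> card S = n \<and> of_nat (card (tops S)) = min_parts n"
proof (induction n rule: less_induct)
  case (less n)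
  show ?case
  proof (cases "n = 0")
    case True
    then show ?thesis by (intro exI[of _ "{}"]) (simp add: down_closed_def tops_def)
  next
    case False
    then obtain k r where k: "1 \<le> k" "n = mers k + r" "r \<le> mers k"
      using mers_interval[of n] by (metis One_nat_def Suc_leI neq0_conv)
    have "0 < mers k" using mers_mono[OF k(1)] by (simp add: mers_Suc)
    then obtain S where S: "finite S" "down_closed S" "card S = r" "of_nat (card (tops S)) = min_parts r"
      using less.IH[of r] k by auto
    obtain j where j: "\<And>b. b \<in> snd ` S \<Longrightarrow> b < j"
      using finite_nat_set_iff_bounded S(1) by (metis finite_imageI)
    define T where "T = subtree (k, j)"
    have kj: "(k, j) \<in> tree_verts" using k by (simp add: tree_verts_def)
    have T: "finite T" "card T = mers k" "down_closed T" "tops T = {(k, j)}"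
      using finite_card_subtree down_closed_subtree tops_subtree[OF kj] by (auto simp: T_def)
    \<comment> \<open>A subtree far to the right misses \<open>S\<close>, and its parent misses \<open>S\<close> because \<open>S\<close> is down-closed.\<close>
    have "snd w \<ge> j" if "w \<in> T" for w
      using that by (cases w) (auto simp: T_def subtree_def tree_parent_pow)
    then have disj: "S \<inter> T = {}" using j by fastforce
    then have tops: "tops (S \<union> T) = tops S \<union> tops T"
      using S(2) T(3) unfolding tops_def down_closed_def by blast
    have "tops S \<inter> tops T = {}" using disj by (auto simp: tops_def)
    moreover have "finite (tops S)" using S(1) by (simp add: tops_def)
    ultimately have "card (tops (S \<union> T)) = card (tops S) + 1"
      unfolding tops T(4) by simp
    then have "of_nat (card (tops (S \<union> T))) = min_parts n"
      using S(4) min_parts_add k by simp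
    moreover have "card (S \<union> T) = n" using disj S T k by (simp add: card_Un_disjoint)
    moreover have "down_closed (S \<union> T)" using S(2) T(3) by (auto simp: down_closed_def)
    ultimately show ?thesis using S(1) T(1) by blast
  qed
qed

section \<open>Cuts and connected complements\<close>

text \<open>Arcs run from child to parent, and no parent in \<open>S\<close> has a child outside, so
  every cut arc leaves \<open>S\<close> upward.\<close>

lemma edge_cut_down_closed:
  assumes "down_closed S"
  shows "edge_cut binary_tree S = (\<lambda>v. (v, tree_parent v)) ` tops S"
proof -
  have arcs: "arcs binary_tree = (\<lambda>v. (v, tree_parent v)) ` tree_verts"
    by (auto simp: binary_tree_def simp del: tree_parent.simps)
  have "edge_cut binary_tree S = {(v, tree_parent v) | v. v \<in> tree_verts \<and>
      (v \<in> S \<and> tree_parent v \<in> tree_verts - S \<or> v \<in> tree_verts - S \<and> tree_parent v \<in> S)}"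
    unfolding edge_cut_def arcs by (auto simp: binary_tree_def simp del: tree_parent.simps)
  also have "\<dots> = (\<lambda>v. (v, tree_parent v)) ` tops S"
    using assms tree_parent_in unfolding tops_def down_closed_def by blast
  finally show ?thesis .
qed

lemma card_edge_cut:
  assumes "down_closed S"
  shows "card (edge_cut binary_tree S) = card (tops S)"
  unfolding edge_cut_down_closed[OF assms] by (rule card_image) (auto simp: inj_on_def)

text \<open>\<open>Digraph_Component.connected\<close> is strong connectivity of the symmetric
  closure, so reachability is studied there.\<close>

abbreviation compl_graph :: "(nat \<times> nat) set \<Rightarrow> (nat \<times> nat) pair_pre_digraph" where
  "compl_graph S \<equiv> mk_symmetric (binary_tree \<restriction> (verts binary_tree - S))"

lemma verts_compl_graph: "verts (with_proj (compl_graph S)) = tree_verts - S"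
  by (simp add: binary_tree_def)

lemma arcs_ends_compl_graph: "arcs_ends (with_proj (compl_graph S)) = parcs (compl_graph S)"
  by simp

lemma parcs_compl_graph:
  "parcs (compl_graph S) = (\<Union>v \<in> {v. v \<in> tree_verts - S \<and> tree_parent v \<notin> S}.
     {(v, tree_parent v), (tree_parent v, v)})"
proof -
  have "arcs (binary_tree \<restriction> (verts binary_tree - S)) =
      (\<lambda>v. (v, tree_parent v)) ` {v. v \<in> tree_verts - S \<and> tree_parent v \<notin> S}"
    by (auto simp: binary_tree_def induce_subgraph_def simp del: tree_parent.simps)
  then show ?thesis
    unfolding parcs_mk_symmetric by (simp add: binary_tree_def)
qed

section \<open>Connected complements and down-closed sets\<close>

lemma down_closed_of_connected:
  assumes "S \<subseteq> tree_verts" "finite S"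
    and "Digraph_Component.connected (binary_tree \<restriction> (verts binary_tree - S))"
  shows "down_closed S"
  unfolding down_closed_def
proof (intro conjI ballI impI assms(1))
  fix v assume v: "v \<in> tree_verts" "tree_parent v \<in> S"
  show "v \<in> S"
  proof (rule ccontr)
    assume vS: "v \<notin> S"
    \<comment> \<open>The only edge leaving \<open>subtree v\<close> goes to \<open>tree_parent v \<in> S\<close>, so \<open>v\<close> is cut off from its far ancestors.\<close>
    obtain m where m: "(tree_parent ^^ m) v \<notin> S \<union> subtree v"
      using exists_ancestor_notin[of "S \<union> subtree v" v] assms(2) finite_card_subtree by (metis finite_UnI surj_pair)
    let ?u = "(tree_parent ^^ m) v"
    have "?u \<in> tree_verts - S" using m v tree_parent_pow_in by auto
    then have "v \<rightarrow>\<^sup>*\<^bsub>compl_graph S\<^esub> ?u"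
      using assms(3) v vS unfolding connected_def strongly_connected_def verts_compl_graph by blast
    then have "?u \<in> subtree v"
      unfolding reachable_def
    proof (induction rule: rtrancl_on_induct)
      case base
      then show ?case using v by (simp add: subtree_self)
    next
      case (step x y)
      then consider "y = tree_parent x" | "x = tree_parent y" "y \<in> tree_verts"
        unfolding arcs_ends_compl_graph parcs_compl_graph by blast
      then show ?case
      proof cases
        case 1
        have "y \<notin> S" using step.hyps unfolding verts_compl_graph by blast
        then have "x \<noteq> v" using v 1 by blast
        then show ?thesis using subtree_parent step.IH 1 by simp
      next
        case 2
        then show ?thesis using subtree_child step.IH by simp
      qed
    qed
    then show False using m by simp
  qed
qed

lemma ancestor_in_compl:
  assumes "down_closed S" "w \<in> tree_verts - S"
  shows "(tree_parent ^^ m) w \<in> tree_verts - S"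
proof (induction m)
  case (Suc m)
  then show ?case using assms(1) tree_parent_in unfolding down_closed_def funpow.simps comp_apply by blast
qed (use assms in simp)

text \<open>Two vertices outside \<open>S\<close> are joined through a common ancestor, since the
  ancestors of a vertex outside \<open>S\<close> stay outside.\<close>

lemma connected_of_down_closed:
  assumes "finite S" "down_closed S"
  shows "Digraph_Component.connected (binary_tree \<restriction> (verts binary_tree - S))"
proof -
  let ?E = "rtrancl_on (tree_verts - S) (parcs (compl_graph S))"
  have up: "(w, (tree_parent ^^ m) w) \<in> ?E \<and> ((tree_parent ^^ m) w, w) \<in> ?E" if "w \<in> tree_verts - S" for w m
  proof (induction m)
    case 0
    then show ?case using that by simp
  next
    case (Suc m)
    let ?x = "(tree_parent ^^ m) w"
    have x: "?x \<in> tree_verts - S"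
      by (rule ancestor_in_compl[OF assms(2) that])
    have y: "tree_parent ?x \<in> tree_verts - S"
      using ancestor_in_compl[OF assms(2) that, of "Suc m"] by simp
    have arcs: "(?x, tree_parent ?x) \<in> parcs (compl_graph S)"
      "(tree_parent ?x, ?x) \<in> parcs (compl_graph S)"
      using x y unfolding parcs_compl_graph by blast+
    show ?case
      using rtrancl_on_into_rtrancl_on[OF _ arcs(1) y] Suc
        converse_rtrancl_on_into_rtrancl_on[OF arcs(2) _ y]
      by (simp only: funpow.simps comp_apply)
  qed
  have meet: "\<exists>m m'. (tree_parent ^^ m) w = (tree_parent ^^ m') w'" for w w'
  proof -
    obtain i j i' j' where w: "w = (i, j)" "w' = (i', j')" by fastforce
    \<comment> \<open>At a level this high, halving has brought both indices to 0, so the paths meet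
      in \<open>(L, 0)\<close>.\<close>
    define L where "L = i + i' + j + j'"
    have "j < 2 ^ (L - i)" "j' < 2 ^ (L - i')"
      by (rule le_less_trans[OF _ less_exp]; simp add: L_def)+
    then show ?thesis
      by (intro exI[of _ "L - i"] exI[of _ "L - i'"]) (simp add: w tree_parent_pow L_def)
  qed
  have "(w, w') \<in> ?E" if "w \<in> tree_verts - S" "w' \<in> tree_verts - S" for w w'
    proof -
    obtain m m' where m: "(tree_parent ^^ m) w = (tree_parent ^^ m') w'" using meet by blast
    show ?thesis
      using rtrancl_on_trans[of w "(tree_parent ^^ m) w" _ _ w'] up[OF that(1), of m]
        up[OF that(2), of m'] unfolding m by blast
  qed
  \<comment> \<open>Strong connectivity includes a nonempty vertex set.\<close>
  moreover have "tree_verts - S \<noteq> {}"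
  proof -
    obtain m where "(tree_parent ^^ m) (1, 0) \<notin> S" using exists_ancestor_notin[OF assms(1)] .
    moreover have "(tree_parent ^^ m) (1, 0) \<in> tree_verts"
      by (rule tree_parent_pow_in) (simp add: tree_verts_def)
    ultimately show ?thesis by blast
  qed
  ultimately show ?thesis
    unfolding connected_def strongly_connected_def reachable_def verts_compl_graph
      arcs_ends_compl_graph by blast
qed

lemma delta_P_eq: "of_nat (delta_P n) = min_parts n"
proof -
  obtain S where S: "finite S" "down_closed S" "card S = n" "of_nat (card (tops S)) = min_parts n"
    using exists_down_closed by blast
  have "delta_P n = card (tops S)"
    unfolding delta_P_def
  proof (rule Least_equality)
    show "\<exists>T. T \<subseteq> verts binary_tree \<and> finite T \<and> card T = n \<and>
        Digraph_Component.connected (binary_tree \<restriction> (verts binary_tree - T)) \<and>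
        card (tops S) = card (edge_cut binary_tree T)"
      using S connected_of_down_closed[OF S(1,2)] card_edge_cut[OF S(2)]
      by (intro exI[of _ S]) (simp add: binary_tree_def down_closed_def)
  next
    fix d
    assume "\<exists>T. T \<subseteq> verts binary_tree \<and> finite T \<and> card T = n \<and>
        Digraph_Component.connected (binary_tree \<restriction> (verts binary_tree - T)) \<and>
        d = card (edge_cut binary_tree T)"
    then obtain T where T: "T \<subseteq> tree_verts" "finite T" "card T = n"
        "Digraph_Component.connected (binary_tree \<restriction> (verts binary_tree - T))"
        "d = card (edge_cut binary_tree T)"
      by (auto simp: binary_tree_def)
    have dc: "down_closed T" using down_closed_of_connected T by blast
    \<comment> \<open>The levels of the tops of \<open>T\<close> describe a partition of
      \<open>n\<close> with one part per cut edge.\<close>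
    have "min_parts n \<le> of_nat (card (tops T))"
      unfolding T(3)[symmetric] card_down_closed[OF T(2) dc]
      using T(1,2) by (intro min_parts_sum_le) (auto simp: tops_def tree_verts_def)
    then have "(of_nat (card (tops S)) :: rat) \<le> of_nat d"
      using S(4) T(5) card_edge_cut[OF dc] by simp
    then show "card (tops S) \<le> d" by simp
  qed
  then show ?thesis using S(4) by simp
qed

theorem theorem3p9:
  "Abs_fps (\<lambda>n. if n \<ge> 1 then of_nat (delta_P n) else 0) =
     (fps_X / (1 - fps_X) *
       (2 * (\<Prod>k. 1 + fps_X ^ (2 ^ Suc k - 1)) - 1 / (1 - fps_X)) :: rat fps)"
proof -
  \<comment> \<open>At \<open>n = 0\<close> both sides vanish, by
    \<open>min_parts_0\<close>.\<close>
  have "(\<lambda>n. if n \<ge> 1 then of_nat (delta_P n) else 0) = min_parts"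
    by (auto simp: delta_P_eq fun_eq_iff not_less_eq_eq)
  then show ?thesis using min_parts_fps unfolding mers_prod_def by simp
qed

end
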